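(* Let $n\ge7$. Let $Q(A_n)=(q_{i,j})_{i,j=1}^n$ be defined by - $q_{i,j}=0$ for $j=1,\dots,n-2$ and $i\le n-j-1$; - $q_{n,1}=q_{1,n}=1$ and $q_{n-i,i}=1$ for $i=1,\dots,n-1$; - $q_{n,2}=q_{2,n}=2$ and $q_{n-i+1,i}=q_{n-i+1,i+1}=2$ for $i=2,\dots,n-1$; - $q_{n-j,i+1}=i+1-j$ for $j=0,\dots,n-2$ and $i=j+2,\dots,n-1$; and let $Q(B_n)=Q(A_n)-D$, where $D=(d_{i,j})_{i,j=1}^n$ is given by - $d_{n-i-1,i}=-1$ for $i=1,\dots,n-2$; - $d_{n-i,i}=-1$ for $i=2,\dots,n-2$; - $d_{n-i+1,i+1}=-1$ for $i=2,\dots,n-2$; - $d_{n-i+1,i+2}=-1$ for $i=2,\dots,n-3$; - $d_{i,j}=0$ otherwise. Then $Q(A_n)$ and $Q(B_n)$, which are proper discrete quasi-copulas, form a dual pair $(Q(A_n),Q(B_n))$.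
   Context: Let $L_n=\{0,1,\dots,n\}$. A matrix $(q_{r,s})_{r,s=1}^n$ is identified with the function $Q:L_n^2\to\mathbb R$, $Q(r,s)=q_{r,s}$ for $r,s\ge1$ and $Q(r,0)=Q(0,s)=0$. A function $Q:L_n^2\to[0,n]$ is a discrete quasi-copula if (Q1') $Q(r,0)=Q(0,s)=0$, $Q(r,n)=r$, $Q(n,s)=s$ for all $r,s\in L_n$; $Q$ is nondecreasing in each variable; and $|Q(r_2,s_2)-Q(r_1,s_1)|\le|r_2-r_1|+|s_2-s_1|$. For $R=[i,j]\times[k,l]$ with $0\le i\le j\le n$, $0\le k\le l\le n$, $V_Q(R)=Q(i,k)+Q(j,l)-Q(i,l)-Q(j,k)$. A discrete quasi-copula is proper if $V_Q(R)<0$ for some $R$. Defects: for $(r,s)\in L_n^2$, $D^Q_{\searrow}(r,s)=\min_{r'\ge r,s'\ge s}V_Q([r,r']\times[s,s'])$, $D^Q_{\nwarrow}(r,s)=\min_{r'\le r,s'\le s}V_Q([r',r]\times[s',s])$, $D^Q_{\swarrow}(r,s)=\min_{r'\ge r,s'\le s}V_Q([r,r']\times[s',s])$, $D^Q_{\nearrow}(r,s)=\min_{r'\le r,s'\ge s}V_Q([r',r]\times[s,s'])$, where $r',s'\in L_n$ (degenerate rectangles contribute $0$). $D_M^Q=\min\{D^Q_{\searrow},D^Q_{\nwarrow}\}$, $D_O^Q=\min\{D^Q_{\swarrow},D^Q_{\nearrow}\}$, $Q_M=Q-D_M^Q$, $Q_O=Q+D_O^Q$. A pair $(P,Q)$ of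 functions $L_n^2\to[0,n]$ is a discrete imprecise copula if both satisfy (Q1') and for every rectangle $[i,j]\times[k,l]$ with integers $0\le i\le j\le n$ and $0\le k\le l\le n$: $Q(i,k)+P(j,l)-P(i,l)-P(j,k)\ge0$, $P(i,k)+Q(j,l)-P(i,l)-P(j,k)\ge0$, $Q(i,k)+Q(j,l)-Q(i,l)-P(j,k)\ge0$, $Q(i,k)+Q(j,l)-P(i,l)-Q(j,k)\ge0$; it is also assumed that $P$ and $Q$ are proper quasi-copulas. A pair $(P,Q)$ is a dual pair if it is a discrete imprecise copula with $P_M=Q$ and $Q_O=P$ (a self-dual discrete imprecise copula). *)

theory Defs
  imports Complex_Main
begin

text \<open>
  Functions on the grid \<open>{0..n} \<times> {0..n}\<close> are represented by total functions on pairs of naturals;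
  every condition below is relativised to the grid, so values outside of it are irrelevant.
\<close>

definition volume :: "(nat \<Rightarrow> nat \<Rightarrow> real) \<Rightarrow> nat \<Rightarrow> nat \<Rightarrow> nat \<Rightarrow> nat \<Rightarrow> real"
  \<comment> \<open>\<open>volume Q i j k l\<close> is the volume of the rectangle \<open>{i..j} \<times> {k..l}\<close>\<close>
  where "volume Q i j k l = Q i k + Q j l - Q i l - Q j k"

definition grid_valued :: "nat \<Rightarrow> (nat \<Rightarrow> nat \<Rightarrow> real) \<Rightarrow> bool"
  where "grid_valued n Q \<longleftrightarrow> (\<forall>r\<in>{0..n}. \<forall>s\<in>{0..n}. 0 \<le> Q r s \<and> Q r s \<le> real n)"

definition boundary_cond :: "nat \<Rightarrow> (nat \<Rightarrow> nat \<Rightarrow> real) \<Rightarrow> bool"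
  where "boundary_cond n Q \<longleftrightarrow>
    (\<forall>r\<in>{0..n}. Q r 0 = 0 \<and> Q r n = real r) \<and>
    (\<forall>s\<in>{0..n}. Q 0 s = 0 \<and> Q n s = real s)"

definition discrete_quasi_copula :: "nat \<Rightarrow> (nat \<Rightarrow> nat \<Rightarrow> real) \<Rightarrow> bool"
  where "discrete_quasi_copula n Q \<longleftrightarrow>
    grid_valued n Q \<and> boundary_cond n Q \<and>
    (\<forall>s\<in>{0..n}. mono_on {0..n} (\<lambda>r. Q r s)) \<and>
    (\<forall>r\<in>{0..n}. mono_on {0..n} (\<lambda>s. Q r s)) \<and>
    (\<forall>r\<^sub>1\<in>{0..n}. \<forall>r\<^sub>2\<in>{0..n}. \<forall>s\<^sub>1\<in>{0..n}. \<forall>s\<^sub>2\<in>{0..n}.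
      \<bar>Q r\<^sub>2 s\<^sub>2 - Q r\<^sub>1 s\<^sub>1\<bar> \<le> \<bar>real r\<^sub>2 - real r\<^sub>1\<bar> + \<bar>real s\<^sub>2 - real s\<^sub>1\<bar>)"

definition proper_discrete_quasi_copula :: "nat \<Rightarrow> (nat \<Rightarrow> nat \<Rightarrow> real) \<Rightarrow> bool"
  where "proper_discrete_quasi_copula n Q \<longleftrightarrow>
    discrete_quasi_copula n Q \<and>
    (\<exists>i j k l. i \<le> j \<and> j \<le> n \<and> k \<le> l \<and> l \<le> n \<and> volume Q i j k l < 0)"

definition defect_SE :: "nat \<Rightarrow> (nat \<Rightarrow> nat \<Rightarrow> real) \<Rightarrow> nat \<Rightarrow> nat \<Rightarrow> real"
  \<comment> \<open>\<open>D\<^sub>\<searrow>\<close>; the arrows follow matrix convention, with the first argument as row index\<close>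
  where "defect_SE n Q r s = Min ((\<lambda>(r', s'). volume Q r r' s s') ` ({r..n} \<times> {s..n}))"

definition defect_NW :: "nat \<Rightarrow> (nat \<Rightarrow> nat \<Rightarrow> real) \<Rightarrow> nat \<Rightarrow> nat \<Rightarrow> real"
  where "defect_NW n Q r s = Min ((\<lambda>(r', s'). volume Q r' r s' s) ` ({0..r} \<times> {0..s}))"

definition defect_SW :: "nat \<Rightarrow> (nat \<Rightarrow> nat \<Rightarrow> real) \<Rightarrow> nat \<Rightarrow> nat \<Rightarrow> real"
  where "defect_SW n Q r s = Min ((\<lambda>(r', s'). volume Q r r' s' s) ` ({r..n} \<times> {0..s}))"

definition defect_NE :: "nat \<Rightarrow> (nat \<Rightarrow> nat \<Rightarrow> real) \<Rightarrow> nat \<Rightarrow> nat \<Rightarrow> real"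
  where "defect_NE n Q r s = Min ((\<lambda>(r', s'). volume Q r' r s s') ` ({0..r} \<times> {s..n}))"

definition main_defect :: "nat \<Rightarrow> (nat \<Rightarrow> nat \<Rightarrow> real) \<Rightarrow> nat \<Rightarrow> nat \<Rightarrow> real"
  where "main_defect n Q r s = min (defect_SE n Q r s) (defect_NW n Q r s)"

definition opposite_defect :: "nat \<Rightarrow> (nat \<Rightarrow> nat \<Rightarrow> real) \<Rightarrow> nat \<Rightarrow> nat \<Rightarrow> real"
  where "opposite_defect n Q r s = min (defect_SW n Q r s) (defect_NE n Q r s)"

definition Q_M :: "nat \<Rightarrow> (nat \<Rightarrow> nat \<Rightarrow> real) \<Rightarrow> nat \<Rightarrow> nat \<Rightarrow> real"
  where "Q_M n Q r s = Q r s - main_defect n Q r s"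

definition Q_O :: "nat \<Rightarrow> (nat \<Rightarrow> nat \<Rightarrow> real) \<Rightarrow> nat \<Rightarrow> nat \<Rightarrow> real"
  where "Q_O n Q r s = Q r s + opposite_defect n Q r s"

definition discrete_imprecise_copula ::
  "nat \<Rightarrow> (nat \<Rightarrow> nat \<Rightarrow> real) \<Rightarrow> (nat \<Rightarrow> nat \<Rightarrow> real) \<Rightarrow> bool"
  where "discrete_imprecise_copula n P Q \<longleftrightarrow>
    grid_valued n P \<and> grid_valued n Q \<and> boundary_cond n P \<and> boundary_cond n Q \<and>
    (\<forall>i j k l. i \<le> j \<longrightarrow> j \<le> n \<longrightarrow> k \<le> l \<longrightarrow> l \<le> n \<longrightarrow>
      Q i k + P j l - P i l - P j k \<ge> 0 \<and>
      P i k + Q j l - P i l - P j k \<ge> 0 \<and>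
      Q i k + Q j l - Q i l - P j k \<ge> 0 \<and>
      Q i k + Q j l - P i l - Q j k \<ge> 0) \<and>
    proper_discrete_quasi_copula n P \<and> proper_discrete_quasi_copula n Q"

definition dual_pair :: "nat \<Rightarrow> (nat \<Rightarrow> nat \<Rightarrow> real) \<Rightarrow> (nat \<Rightarrow> nat \<Rightarrow> real) \<Rightarrow> bool"
  where "dual_pair n P Q \<longleftrightarrow>
    discrete_imprecise_copula n P Q \<and>
    (\<forall>r\<in>{0..n}. \<forall>s\<in>{0..n}. Q_M n P r s = Q r s) \<and>
    (\<forall>r\<in>{0..n}. \<forall>s\<in>{0..n}. Q_O n Q r s = P r s)"

definition grid_fun :: "(nat \<Rightarrow> nat \<Rightarrow> real) \<Rightarrow> nat \<Rightarrow> nat \<Rightarrow> real"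
  \<comment> \<open>identification of a matrix with indices \<open>1, \<dots>, n\<close> with a function on the grid\<close>
  where "grid_fun q r s = (if r = 0 \<or> s = 0 then 0 else q r s)"

definition mat_A :: "nat \<Rightarrow> nat \<Rightarrow> nat \<Rightarrow> real"
  \<comment> \<open>The last branch covers the entries \<open>q\<^bsub>n-j,i+1\<^esub> = i + 1 - j\<close>, where \<open>j = n - r\<close> and
    \<open>i = s - 1\<close>. For \<open>n \<ge> 7\<close> the lemmas below show that all prescribed values are attained and that the
    prescriptions cover all indices, so the order of the branches does not matter.\<close>
  where "mat_A n r s =
    (if \<exists>j\<in>{1..n-2}. s = j \<and> 1 \<le> r \<and> r \<le> n - j - 1 then 0
     else if (r = n \<and> s = 1) \<or> (r = 1 \<and> s = n) \<or> (\<exists>i\<in>{1..n-1}. r = n - i \<and> s = i) then 1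
     else if (r = n \<and> s = 2) \<or> (r = 2 \<and> s = n) \<or>
       (\<exists>i\<in>{2..n-1}. r = n - i + 1 \<and> (s = i \<or> s = i + 1)) then 2
     else real r + real s - real n)"

definition mat_D :: "nat \<Rightarrow> nat \<Rightarrow> nat \<Rightarrow> real"
  where "mat_D n r s =
    (if (\<exists>i\<in>{1..n-2}. r = n - i - 1 \<and> s = i) \<or>
        (\<exists>i\<in>{2..n-2}. r = n - i \<and> s = i) \<or>
        (\<exists>i\<in>{2..n-2}. r = n - i + 1 \<and> s = i + 1) \<or>
        (\<exists>i\<in>{2..n-3}. r = n - i + 1 \<and> s = i + 2)
     then - 1 else 0)"

definition Q_A :: "nat \<Rightarrow> nat \<Rightarrow> nat \<Rightarrow> real"
  where "Q_A n = grid_fun (mat_A n)"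

definition Q_B :: "nat \<Rightarrow> nat \<Rightarrow> nat \<Rightarrow> real"
  where "Q_B n = grid_fun (\<lambda>r s. mat_A n r s - mat_D n r s)"

lemma mat_A_sum:
  assumes "n \<ge> 7" "r \<in> {1..n}" "s \<in> {1..n}"
  shows "mat_A n r s =
    (if r + s < n then 0
     else if r + s = n \<or> (r = n \<and> s = 1) \<or> (r = 1 \<and> s = n) then 1
     else if r + s \<le> n + 2 then 2
     else real r + real s - real n)"
proof -
  have 0: "(\<exists>j\<in>{1..n-2}. s = j \<and> 1 \<le> r \<and> r \<le> n - j - 1) \<longleftrightarrow> r + s < n"
      (is "?L \<longleftrightarrow> ?R")
  proof
    assume ?R
    then show ?L using assms by (intro bexI[of _ s]) auto
  qed auto
  have 1: "(\<exists>i\<in>{1..n-1}. r = n - i \<and> s = i) \<longleftrightarrow> r + s = n" (is "?L \<longleftrightarrow> ?R")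
  proof
    assume ?R
    then show ?L using assms by (intro bexI[of _ s]) auto
  qed auto
  have 2: "(\<exists>i\<in>{2..n-1}. r = n - i + 1 \<and> (s = i \<or> s = i + 1)) \<longleftrightarrow>
      (r + s = n + 1 \<and> 2 \<le> s \<and> s < n) \<or> (r + s = n + 2 \<and> 3 \<le> s)" (is "?L \<longleftrightarrow> ?R")
  proof
    assume ?L
    then obtain i where "i \<in> {2..n-1}" "r = n - i + 1" "s = i \<or> s = i + 1" by blast
    then show ?R by auto
  next
    assume ?R
    then show ?L
    proof
      assume "r + s = n + 1 \<and> 2 \<le> s \<and> s < n"
      then show ?L by (intro bexI[of _ s]) auto
    next
      assume "r + s = n + 2 \<and> 3 \<le> s"
      then show ?L using assms by (intro bexI[of _ "s - 1"]) auto
    qed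
  qed
  have 3: "(r = n \<and> s = 2) \<or> (r = 2 \<and> s = n) \<or>
      ((r + s = n + 1 \<and> 2 \<le> s \<and> s < n) \<or> (r + s = n + 2 \<and> 3 \<le> s)) \<longleftrightarrow> r + s \<le> n + 2"
    if h: "\<not> r + s < n \<and> \<not> (r = n \<and> s = 1 \<or> r = 1 \<and> s = n \<or> r + s = n)"
  proof -
    have rs: "1 \<le> s" "r \<le> n" "s \<le> n" using assms by auto
    consider "r + s = n + 1" | "r + s = n + 2" | "r + s > n + 2" using h by linarith
    then show ?thesis
    proof cases
      case 1
      then have "2 \<le> s" "s < n" using h rs by linarith+
      with 1 show ?thesis by simp
    next
      case 2
      then have "s = 2 \<and> r = n \<or> 3 \<le> s" using rs by linarith
      with 2 show ?thesis by auto
    next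
      case 3
      then show ?thesis using rs by auto
    qed
  qed
  show ?thesis
    unfolding mat_A_def 0 1 2 using 3 by argo
qed

lemma mat_A_zero:
  assumes "n \<ge> 7" "j \<in> {1..n-2}" "1 \<le> i" "i \<le> n - j - 1"
  shows "mat_A n i j = 0"
proof -
  have "i \<in> {1..n}" "j \<in> {1..n}" "i + j < n" using assms by auto
  then show ?thesis using mat_A_sum assms(1) by simp
qed

lemma mat_A_one:
  assumes "n \<ge> 7"
  shows "mat_A n n 1 = 1" "mat_A n 1 n = 1"
    and "i \<in> {1..n-1} \<Longrightarrow> mat_A n (n - i) i = 1"
proof -
  show "mat_A n (n - i) i = 1" if "i \<in> {1..n-1}"
  proof -
    have "n - i \<in> {1..n}" "i \<in> {1..n}" "n - i + i = n" using that by auto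
    then show ?thesis using mat_A_sum assms by simp
  qed
qed (use assms in \<open>simp_all add: mat_A_sum\<close>)

lemma mat_A_two:
  assumes "n \<ge> 7"
  shows "mat_A n n 2 = 2" "mat_A n 2 n = 2"
    and "i \<in> {2..n-1} \<Longrightarrow> mat_A n (n - i + 1) i = 2"
    and "i \<in> {2..n-1} \<Longrightarrow> mat_A n (n - i + 1) (i + 1) = 2"
proof -
  show "mat_A n (n - i + 1) i = 2" if "i \<in> {2..n-1}"
  proof -
    have "n - i + 1 \<in> {1..n}" "i \<in> {1..n}" "n - i + 1 + i = n + 1" "i \<noteq> 1" "i \<noteq> n"
      using that by auto
    then show ?thesis using mat_A_sum[OF assms, of "n - i + 1" i] by simp
  qed
  show "mat_A n (n - i + 1) (i + 1) = 2" if "i \<in> {2..n-1}"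
  proof -
    have "n - i + 1 \<in> {1..n}" "i + 1 \<in> {1..n}" "n - i + 1 + (i + 1) = n + 2" "i \<noteq> 0" "n - i \<noteq> 0"
      using that by auto
    then show ?thesis using mat_A_sum[OF assms, of "n - i + 1" "i + 1"] by simp
  qed
qed (use assms in \<open>simp_all add: mat_A_sum\<close>)

lemma mat_A_rest:
  assumes "n \<ge> 7" "j \<in> {0..n-2}" "i \<in> {j+2..n-1}"
  shows "mat_A n (n - j) (i + 1) = real i + 1 - real j"
proof -
  have "n - j \<in> {1..n}" "i + 1 \<in> {1..n}" "n - j + (i + 1) > n + 2" "j \<le> n" "i \<noteq> 0" "n - j \<noteq> 1"
    using assms by auto
  then show ?thesis
    using mat_A_sum[OF assms(1), of "n - j" "i + 1"] by (simp add: of_nat_diff)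
qed

lemma mat_A_cases:
  fixes n r s :: nat
  assumes "n \<ge> 7" "r \<in> {1..n}" "s \<in> {1..n}"
  shows "(s \<in> {1..n-2} \<and> r \<le> n - s - 1) \<or>
    (r = n \<and> s = 1) \<or> (r = 1 \<and> s = n) \<or> (\<exists>i\<in>{1..n-1}. r = n - i \<and> s = i) \<or>
    (r = n \<and> s = 2) \<or> (r = 2 \<and> s = n) \<or>
    (\<exists>i\<in>{2..n-1}. r = n - i + 1 \<and> (s = i \<or> s = i + 1)) \<or>
    (\<exists>j\<in>{0..n-2}. \<exists>i\<in>{j+2..n-1}. r = n - j \<and> s = i + 1)"
proof -
  consider "r + s < n" | "r + s = n" | "r + s = n + 1" | "r + s = n + 2" | "r + s \<ge> n + 3"
    by linarith
  then show ?thesis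
  proof cases
    case 1
    then show ?thesis using assms by auto
  next
    case 2
    then have "s \<in> {1..n-1} \<and> r = n - s" using assms by auto
    then show ?thesis by blast
  next
    case 3
    then have "s = 1 \<and> r = n \<or> s = n \<and> r = 1 \<or> s \<in> {2..n-1} \<and> r = n - s + 1"
      using assms by auto
    then show ?thesis by blast
  next
    case 4
    then have "s = 2 \<and> r = n \<or> s - 1 \<in> {2..n-1} \<and> r = n - (s - 1) + 1 \<and> s = (s - 1) + 1"
      using assms by auto
    then show ?thesis by blast
  next
    case 5
    then have "n - r \<in> {0..n-2} \<and> s - 1 \<in> {(n - r) + 2..n-1} \<and> r = n - (n - r) \<and> s = (s - 1) + 1"
      using assms by auto
    then show ?thesis by blast
  qed
qed

end

theory Submission
  imports Defs
begin

text \<open>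
  On the grid the two functions have the form \<open>min r (min s (f (r + s - n)))\<close>, with profiles \<open>f\<close>
  that are nondecreasing and 1-Lipschitz. For functions of this form each of the four rectangle
  inequalities reduces to an inequality between profiles on the line. The four inequalities say
  exactly that the defects are at least \<open>Q_A - Q_B\<close>, so it remains to exhibit, at every point where
  \<open>Q_A\<close> and \<open>Q_B\<close> differ, a rectangle of volume \<open>-1\<close> for each of them; its sides have length at most 2.
\<close>

section \<open>Truncated profiles on the grid\<close>

definition truncated :: "nat \<Rightarrow> (int \<Rightarrow> int) \<Rightarrow> nat \<Rightarrow> nat \<Rightarrow> int"
  where "truncated n f r s = min (int r) (min (int s) (f (int r + int s - int n)))"

text \<open>The bounds \<open>0 \<le> f x\<close> and \<open>x \<le> f x\<close> encode the boundary
  conditions: the first makes \<open>truncated n f\<close> vanish where a coordinate is 0, the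
  second gives it the value \<open>r\<close> at \<open>s = n\<close>, where \<open>f\<close> is
  evaluated at \<open>r\<close> itself.\<close>

definition profile :: "(int \<Rightarrow> int) \<Rightarrow> bool"
  where "profile f \<longleftrightarrow> (\<forall>x. 0 \<le> f x \<and> x \<le> f x \<and> f x \<le> f (x + 1) \<and> f (x + 1) \<le> f x + 1)"

lemma profile_increment:
  assumes "profile f" "0 \<le> a"
  shows "f x \<le> f (x + a) \<and> f (x + a) \<le> f x + a"
  using assms(2)
proof (induction a rule: int_ge_induct)
  case (step a)
  have "f (x + a) \<le> f (x + a + 1) \<and> f (x + a + 1) \<le> f (x + a) + 1"
    using assms(1) unfolding profile_def by blast
  with step show ?case by (simp add: add.assoc)
qed simp

lemma truncated_commute: "truncated n f r s = truncated n f s r"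
  unfolding truncated_def by (simp add: min.left_commute add.commute)

lemma truncated_increment:
  assumes "profile f"
  shows "truncated n f r s \<le> truncated n f (r + a) s"
    and "truncated n f (r + a) s \<le> truncated n f r s + int a"
  using profile_increment[OF assms, of "int a" "int r + int s - int n"]
  unfolding truncated_def by (simp_all add: algebra_simps min_def)

lemma truncated_mono:
  assumes "profile f" "r \<le> r'" "s \<le> s'"
  shows "truncated n f r s \<le> truncated n f r' s'"
proof -
  obtain a b where "r' = r + a" "s' = s + b" using assms(2,3) by (auto simp: le_iff_add)
  then show ?thesis
    using truncated_increment(1)[OF assms(1)] truncated_commute order_trans by metis
qed

lemma truncated_increment_le:
  assumes "profile f" "r \<le> r'"
  shows "truncated n f r' s \<le> truncated n f r s + (int r' - int r)"
  using truncated_increment(2)[OF assms(1), of n r "r' - r" s] assms(2) by (simp add: of_nat_diff)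

lemma truncated_lipschitz:
  assumes "profile f"
  shows "\<bar>truncated n f r' s' - truncated n f r s\<bar> \<le> \<bar>int r' - int r\<bar> + \<bar>int s' - int s\<bar>"
proof -
  have step: "\<bar>truncated n f r' s - truncated n f r s\<bar> \<le> \<bar>int r' - int r\<bar>" for r r' s
    using truncated_increment_le[OF assms, of r r' n s] truncated_mono[OF assms, of r r' s s n]
      truncated_increment_le[OF assms, of r' r n s] truncated_mono[OF assms, of r' r s s n]
    by linarith
  \<comment> \<open>The path runs from \<open>(r, s)\<close> through \<open>(r, s')\<close> to
    \<open>(r', s')\<close>; its leg in the second coordinate is \<open>step\<close> after
    transposition.\<close>
  from step[of r' s' r] step[of s' r s] show ?thesis
    by (simp add: truncated_commute[of n f r])
qed

lemma truncated_le_truncated: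
  assumes "\<And>x. f x \<le> g x" "profile f" "r \<le> r'" "s \<le> s'"
  shows "truncated n f r s \<le> truncated n g r' s'"
proof -
  have "truncated n f r' s' \<le> truncated n g r' s'"
    unfolding truncated_def using assms(1) by (intro min.mono) auto
  then show ?thesis using truncated_mono[OF assms(2-4)] order_trans by blast
qed

text \<open>Each term on the right is a coordinate or a profile value. If both are profile values,
  \<open>line\<close> applies with \<open>x = i + k - n\<close>, \<open>a = j - i\<close>,
  \<open>b = l - k\<close>. If the \<open>u\<close> term is \<open>i\<close> or \<open>k\<close>,
  that coordinate bounds one term on the left and the \<open>v\<close> term dominates the other. If
  the \<open>v\<close> term is \<open>j\<close> or \<open>l\<close>, one term on the left is at most
  \<open>i\<close> or \<open>k\<close>, and the other exceeds the \<open>u\<close> term by at most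
  the side length.\<close>

lemma truncated_rectangle:
  assumes "profile w" "profile z"
    and le: "\<And>x. w x \<le> u x" "\<And>x. w x \<le> v x" "\<And>x. z x \<le> u x" "\<And>x. z x \<le> v x"
    and line: "\<And>x a b. 0 \<le> a \<Longrightarrow> 0 \<le> b \<Longrightarrow> w (x + a) + z (x + b) \<le> u x + v (x + a + b)"
    and "i \<le> j" "k \<le> l"
  shows "truncated n w j k + truncated n z i l \<le> truncated n u i k + truncated n v j l"
proof -
  have z: "truncated n z i l \<le> int i" "truncated n z i l \<le> z (int i + int l - int n)"
    and w: "truncated n w j k \<le> int k" "truncated n w j k \<le> w (int j + int k - int n)"
    unfolding truncated_def by linarith+
  have "truncated n w j k \<le> truncated n w i k + (int j - int i)"
    using truncated_increment_le assms by blast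
  moreover have "truncated n w i k \<le> truncated n u i k" "truncated n z i k \<le> truncated n u i k"
    "truncated n w j k \<le> truncated n v j l" "truncated n z i l \<le> truncated n v j l"
    using truncated_le_truncated assms by blast+
  moreover have "truncated n z i l \<le> truncated n z i k + (int l - int k)"
    using truncated_increment_le[OF assms(2) \<open>k \<le> l\<close>] by (simp add: truncated_commute[of n z i])
  moreover have "w (int j + int k - int n) + z (int i + int l - int n)
      \<le> u (int i + int k - int n) + v (int j + int l - int n)"
    using line[of "int j - int i" "int l - int k" "int i + int k - int n"] assms(8,9)
    by (simp add: algebra_simps)
  moreover have "truncated n u i k = int i \<or> truncated n u i k = int k \<or>
      truncated n u i k = u (int i + int k - int n)"
    and "truncated n v j l = int j \<or> truncated n v j l = int l \<or>
      truncated n v j l = v (int j + int l - int n)"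
    unfolding truncated_def by linarith+
  ultimately show ?thesis using z w by linarith
qed

section \<open>Quasi-copulas from profiles\<close>

lemma volume_of_int:
  assumes "\<And>r s. r \<le> n \<Longrightarrow> s \<le> n \<Longrightarrow> Q r s = of_int (F r s)" "i \<le> n" "j \<le> n" "k \<le> n" "l \<le> n"
  shows "volume Q i j k l = of_int (F i k + F j l - F i l - F j k)"
  unfolding volume_def using assms by simp

lemma discrete_quasi_copula_truncated:
  assumes Q: "\<And>r s. r \<le> n \<Longrightarrow> s \<le> n \<Longrightarrow> Q r s = of_int (truncated n f r s)"
    and f: "profile f"
  shows "discrete_quasi_copula n Q"
proof -
  have nonneg: "0 \<le> f x" and ge: "x \<le> f x" for x using f unfolding profile_def by auto
  have 0: "truncated n f r 0 = 0" for r
    unfolding truncated_def using nonneg by simp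
  have n: "truncated n f r n = int r" if "r \<le> n" for r
    unfolding truncated_def using ge[of "int r"] that by simp
  have "grid_valued n Q"
    unfolding grid_valued_def
  proof (intro ballI)
    fix r s assume "r \<in> {0..n}" "s \<in> {0..n}"
    then show "0 \<le> Q r s \<and> Q r s \<le> real n"
      using nonneg by (simp add: Q truncated_def min_def)
  qed
  moreover have "boundary_cond n Q"
    unfolding boundary_cond_def by (simp add: Q 0 n truncated_commute[of n f 0] truncated_commute[of n f n])
  moreover have "\<forall>s\<in>{0..n}. mono_on {0..n} (\<lambda>r. Q r s)" "\<forall>r\<in>{0..n}. mono_on {0..n} (\<lambda>s. Q r s)"
    by (auto intro!: mono_onI truncated_mono f simp: Q)
  moreover have "\<bar>Q r' s' - Q r s\<bar> \<le> \<bar>real r' - real r\<bar> + \<bar>real s' - real s\<bar>"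
    if "r \<le> n" "r' \<le> n" "s \<le> n" "s' \<le> n" for r r' s s'
  proof -
    have "real_of_int \<bar>truncated n f r' s' - truncated n f r s\<bar>
        \<le> real_of_int (\<bar>int r' - int r\<bar> + \<bar>int s' - int s\<bar>)"
      using truncated_lipschitz[OF f] of_int_le_iff by blast
    then show ?thesis using that by (simp add: Q)
  qed
  ultimately show ?thesis unfolding discrete_quasi_copula_def by auto
qed

section \<open>Defects as attained lower bounds\<close>

lemma min_Min_eqI:
  fixes c :: "'a :: linorder"
  assumes "finite S" "finite T" "S \<noteq> {}" "T \<noteq> {}"
    and "\<And>x. x \<in> S \<Longrightarrow> c \<le> x" "\<And>x. x \<in> T \<Longrightarrow> c \<le> x" "c \<in> S \<or> c \<in> T"
  shows "min (Min S) (Min T) = c"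
proof (rule antisym)
  show "min (Min S) (Min T) \<le> c" using assms by (auto intro: min.coboundedI1 min.coboundedI2)
  show "c \<le> min (Min S) (Min T)" using assms by simp
qed

text \<open>Attainment is a disjunction because the direction of the extremal rectangle varies: for
  \<open>Q_A\<close>, witnesses lie to the south-east when \<open>r + s \<le> n\<close> and to the
  north-west beyond.\<close>

lemma main_defect_eqI:
  assumes "r \<le> n" "s \<le> n"
    and "\<And>r' s'. r \<le> r' \<Longrightarrow> r' \<le> n \<Longrightarrow> s \<le> s' \<Longrightarrow> s' \<le> n \<Longrightarrow> c \<le> volume Q r r' s s'"
    and "\<And>r' s'. r' \<le> r \<Longrightarrow> s' \<le> s \<Longrightarrow> c \<le> volume Q r' r s' s"
    and "(\<exists>r' s'. r \<le> r' \<and> r' \<le> n \<and> s \<le> s' \<and> s' \<le> n \<and> volume Q r r' s s' = c) \<or>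
      (\<exists>r' s'. r' \<le> r \<and> s' \<le> s \<and> volume Q r' r s' s = c)"
  shows "main_defect n Q r s = c"
  unfolding main_defect_def defect_SE_def defect_NW_def
  by (rule min_Min_eqI) (use assms in \<open>force+\<close>)

lemma opposite_defect_eqI:
  assumes "r \<le> n" "s \<le> n"
    and "\<And>r' s'. r \<le> r' \<Longrightarrow> r' \<le> n \<Longrightarrow> s' \<le> s \<Longrightarrow> c \<le> volume Q r r' s' s"
    and "\<And>r' s'. r' \<le> r \<Longrightarrow> s \<le> s' \<Longrightarrow> s' \<le> n \<Longrightarrow> c \<le> volume Q r' r s s'"
    and "(\<exists>r' s'. r \<le> r' \<and> r' \<le> n \<and> s' \<le> s \<and> volume Q r r' s' s = c) \<or>
      (\<exists>r' s'. r' \<le> r \<and> s \<le> s' \<and> s' \<le> n \<and> volume Q r' r s s' = c)"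
  shows "opposite_defect n Q r s = c"
  unfolding opposite_defect_def defect_SW_def defect_NE_def
  by (rule min_Min_eqI) (use assms in \<open>force+\<close>)

section \<open>The two profiles and their inequalities on the line\<close>

definition prof_A :: "int \<Rightarrow> int"
  where "prof_A x = (if x < 0 then 0 else if x = 0 then 1 else if x = 1 then 2 else x)"

text \<open>While \<open>prof_A\<close> is \<open>max 0 x\<close> raised by one at 0 and 1, this
  raises \<open>prof_A\<close> by one exactly at -1, 0, 2 and 3, the antidiagonals carrying the
  nonzero entries of \<open>mat_D\<close>.\<close>

definition prof_B :: "int \<Rightarrow> int"
  where "prof_B x = (if x < -1 then 0 else if x \<le> 0 then x + 2
    else if x = 1 then 2 else if x \<le> 3 then x + 1 else x)"

lemma profile_prof_A: "profile prof_A"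
  unfolding profile_def prof_A_def by simp

lemma profile_prof_B: "profile prof_B"
  unfolding profile_def prof_B_def by simp

lemma prof_A_le_prof_B: "prof_A x \<le> prof_B x"
  unfolding prof_A_def prof_B_def by simp

text \<open>In this name and the next three, the first two letters are the profiles at
  \<open>x\<close> and \<open>x + a + b\<close>, the last two those at \<open>x + a\<close> and
  \<open>x + b\<close>. Here the gain of \<open>prof_B\<close> over \<open>prof_A\<close> at
  \<open>x\<close> pays for the failure of convexity of \<open>prof_A\<close>.\<close>

lemma line_BA_AA:
  assumes "0 \<le> a" "0 \<le> b"
  shows "prof_A (x + a) + prof_A (x + b) \<le> prof_B x + prof_A (x + a + b)"
  using assms unfolding prof_A_def prof_B_def by auto

lemma line_AB_AA:
  assumes "0 \<le> a" "0 \<le> b"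
  shows "prof_A (x + a) + prof_A (x + b) \<le> prof_A x + prof_B (x + a + b)"
  using assms unfolding prof_A_def prof_B_def by auto

lemma line_BB_AB:
  assumes "0 \<le> a" "0 \<le> b"
  shows "prof_A (x + a) + prof_B (x + b) \<le> prof_B x + prof_B (x + a + b)"
  using assms unfolding prof_A_def prof_B_def by auto

lemma line_BB_BA:
  assumes "0 \<le> a" "0 \<le> b"
  shows "prof_B (x + a) + prof_A (x + b) \<le> prof_B x + prof_B (x + a + b)"
  using line_BB_AB[OF assms(2,1), of x] by (simp add: add.commute add.left_commute)

section \<open>Identification with the matrices\<close>

lemma Q_A_eq:
  assumes "n \<ge> 7" "r \<le> n" "s \<le> n"
  shows "Q_A n r s = of_int (truncated n prof_A r s)"
proof (cases "r = 0 \<or> s = 0")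
  case True
  then show ?thesis by (auto simp: Q_A_def grid_fun_def truncated_def prof_A_def)
next
  case False
  then have "Q_A n r s = mat_A n r s" "r \<in> {1..n}" "s \<in> {1..n}"
    using assms by (auto simp: Q_A_def grid_fun_def)
  \<comment> \<open>The exceptional entries 1 at \<open>(n, 1)\<close> and \<open>(1, n)\<close>
    come from truncation: the profile value there is 2, but a coordinate is 1.\<close>
  then show ?thesis
    using assms mat_A_sum[of n r s] by (auto simp: truncated_def prof_A_def min_def)
qed

text \<open>A gain of \<open>prof_B\<close> survives truncation only if both coordinates reach its
  new value, which is 1, 2, 3, 4 on the four antidiagonals in turn; this explains the bounds on
  \<open>r\<close> and \<open>s\<close>.\<close>

definition differ :: "nat \<Rightarrow> nat \<Rightarrow> nat \<Rightarrow> bool"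
  where "differ n r s \<longleftrightarrow> 1 \<le> r \<and> 1 \<le> s \<and>
    (r + s + 1 = n \<or>
     r + s = n \<and> 2 \<le> r \<and> 2 \<le> s \<or>
     r + s = n + 2 \<and> 3 \<le> r \<and> 3 \<le> s \<or>
     r + s = n + 3 \<and> 4 \<le> r \<and> 4 \<le> s)"

lemma mat_D_sum:
  assumes "r \<in> {1..n}" "s \<in> {1..n}"
  shows "mat_D n r s = (if differ n r s then -1 else 0)"
proof -
  have 1: "(\<exists>i\<in>{1..n-2}. r = n - i - 1 \<and> s = i) \<longleftrightarrow> r + s + 1 = n" (is "?L \<longleftrightarrow> ?R")
  proof
    assume ?R
    then show ?L using assms by (intro bexI[of _ s]) auto
  qed (use assms in auto)
  have 2: "(\<exists>i\<in>{2..n-2}. r = n - i \<and> s = i) \<longleftrightarrow> r + s = n \<and> 2 \<le> r \<and> 2 \<le> s" (is "?L \<longleftrightarrow> ?R")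
  proof
    assume ?R
    then show ?L using assms by (intro bexI[of _ s]) auto
  qed auto
  have 3: "(\<exists>i\<in>{2..n-2}. r = n - i + 1 \<and> s = i + 1) \<longleftrightarrow> r + s = n + 2 \<and> 3 \<le> r \<and> 3 \<le> s"
    (is "?L \<longleftrightarrow> ?R")
  proof
    assume ?R
    then show ?L using assms by (intro bexI[of _ "s - 1"]) auto
  qed auto
  have 4: "(\<exists>i\<in>{2..n-3}. r = n - i + 1 \<and> s = i + 2) \<longleftrightarrow> r + s = n + 3 \<and> 4 \<le> r \<and> 4 \<le> s"
    (is "?L \<longleftrightarrow> ?R")
  proof
    assume ?R
    then show ?L using assms by (intro bexI[of _ "s - 2"]) auto
  qed auto
  show ?thesis unfolding mat_D_def 1 2 3 4 differ_def using assms by simp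
qed

lemma truncated_prof_B:
  assumes "r \<le> n" "s \<le> n"
  shows "truncated n prof_B r s = truncated n prof_A r s + (if differ n r s then 1 else 0)"
proof -
  define d where "d = int r + int s - int n"
  have d: "r + s + 1 = n \<longleftrightarrow> d = -1" "r + s = n \<longleftrightarrow> d = 0" "r + s = n + 2 \<longleftrightarrow> d = 2"
    "r + s = n + 3 \<longleftrightarrow> d = 3" and le: "d \<le> int r" "d \<le> int s"
    using assms unfolding d_def by auto
  show ?thesis
    using le unfolding truncated_def prof_A_def prof_B_def differ_def d d_def[symmetric]
    by (auto simp: min_def)
qed

lemma Q_B_eq:
  assumes "n \<ge> 7" "r \<le> n" "s \<le> n"
  shows "Q_B n r s = of_int (truncated n prof_B r s)"
proof (cases "r = 0 \<or> s = 0")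
  case True
  then show ?thesis by (auto simp: Q_B_def grid_fun_def truncated_def prof_B_def)
next
  case False
  then have "Q_B n r s = Q_A n r s - mat_D n r s"
    by (auto simp: Q_A_def Q_B_def grid_fun_def)
  then show ?thesis
    using False assms by (simp add: Q_A_eq mat_D_sum truncated_prof_B)
qed

lemma differ_commute: "differ n r s \<longleftrightarrow> differ n s r"
  unfolding differ_def by auto

section \<open>Rectangles of volume -1\<close>

lemma volume_A:
  assumes "n \<ge> 7" "i \<le> n" "j \<le> n" "k \<le> n" "l \<le> n"
  shows "volume (Q_A n) i j k l = of_int (truncated n prof_A i k + truncated n prof_A j l
    - truncated n prof_A i l - truncated n prof_A j k)"
  by (rule volume_of_int[OF Q_A_eq]) (use assms in auto)

lemma volume_B:
  assumes "n \<ge> 7" "i \<le> n" "j \<le> n" "k \<le> n" "l \<le> n"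
  shows "volume (Q_B n) i j k l = of_int (truncated n prof_B i k + truncated n prof_B j l
    - truncated n prof_B i l - truncated n prof_B j k)"
  by (rule volume_of_int[OF Q_B_eq]) (use assms in auto)

text \<open>Each rectangle has an off-diagonal corner on \<open>r + s = n + 1\<close>, where
  \<open>prof_A\<close> fails to be convex. With \<open>f = prof_A\<close>, the volumes are
  \<open>f (-1) + f 2 - f 0 - f 1\<close>, \<open>f 0 + f 2 - 2 * f 1\<close> and
  \<open>f (-1) + f 3 - 2 * f 1\<close>.\<close>

lemma main_witness:
  assumes "n \<ge> 7" "r \<le> n" "s \<le> n" "differ n r s"
  shows "(\<exists>r' s'. r \<le> r' \<and> r' \<le> n \<and> s \<le> s' \<and> s' \<le> n \<and> volume (Q_A n) r r' s s' = -1) \<or>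
    (\<exists>r' s'. r' \<le> r \<and> s' \<le> s \<and> volume (Q_A n) r' r s' s = -1)"
proof -
  note [simp] = truncated_def prof_A_def
  have "1 \<le> r" "1 \<le> s" using assms(4) unfolding differ_def by auto
  \<comment> \<open>On the first antidiagonal the corner with profile value 2 keeps either
    \<open>r\<close> or \<open>s\<close>, which must be at least 2 to avoid truncation. Since
    \<open>r + s = n - 1 \<ge> 6\<close>, at least one orientation works.\<close>
  consider "r + s + 1 = n" "2 \<le> r" | "r + s + 1 = n" "2 \<le> s" | "r + s = n" "2 \<le> r" "2 \<le> s"
    | "r + s = n + 2" "3 \<le> r" "3 \<le> s" | "r + s = n + 3" "4 \<le> r" "4 \<le> s"
    using assms(1,4) unfolding differ_def by linarith
  then show ?thesis
  proof cases
    case 1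
    then have "volume (Q_A n) r (r + 1) s (s + 2) = -1"
      using assms \<open>1 \<le> s\<close> by (subst volume_A) auto
    then show ?thesis using 1 by (intro disjI1 exI[of _ "r + 1"] exI[of _ "s + 2"]) auto
  next
    case 2
    then have "volume (Q_A n) r (r + 2) s (s + 1) = -1"
      using assms \<open>1 \<le> r\<close> by (subst volume_A) auto
    then show ?thesis using 2 by (intro disjI1 exI[of _ "r + 2"] exI[of _ "s + 1"]) auto
  next
    case 3
    then have "volume (Q_A n) r (r + 1) s (s + 1) = -1"
      using assms by (subst volume_A) auto
    then show ?thesis using 3 by (intro disjI1 exI[of _ "r + 1"] exI[of _ "s + 1"]) auto
  next
    case 4
    then have "volume (Q_A n) (r - 1) r (s - 1) s = -1"
      using assms by (subst volume_A) auto
    then show ?thesis by (intro disjI2 exI[of _ "r - 1"] exI[of _ "s - 1"]) auto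
  next
    case 5
    then have "volume (Q_A n) (r - 2) r (s - 2) s = -1"
      using assms by (subst volume_A) auto
    then show ?thesis by (intro disjI2 exI[of _ "r - 2"] exI[of _ "s - 2"]) auto
  qed
qed

text \<open>The rectangles extend to column \<open>s - 1\<close>, so \<open>s\<close> must be large
  enough for the corner values there to escape truncation; \<open>r \<le> s\<close> together with
  \<open>n \<ge> 7\<close> ensures this. The remaining points follow by transposition.\<close>

lemma SW_witness:
  assumes "n \<ge> 7" "r \<le> n" "s \<le> n" "differ n r s" "r \<le> s"
  shows "\<exists>r' s'. r \<le> r' \<and> r' \<le> n \<and> s' \<le> s \<and> volume (Q_B n) r r' s' s = -1"
proof -
  note [simp] = truncated_def prof_B_def
  have "1 \<le> r" using assms(4) unfolding differ_def by auto
  consider "r + s + 1 = n" | "r + s = n" "2 \<le> r"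
    | "r + s = n + 2" "3 \<le> r" | "r + s = n + 3" "4 \<le> r"
    using assms(4) unfolding differ_def by linarith
  then show ?thesis
  proof cases
    case 1
    then have "volume (Q_B n) r (r + 2) (s - 1) s = -1"
      using assms \<open>1 \<le> r\<close> by (subst volume_B) auto
    then show ?thesis using 1 assms by (intro exI[of _ "r + 2"] exI[of _ "s - 1"]) auto
  next
    case 2
    then have "volume (Q_B n) r (r + 1) (s - 1) s = -1"
      using assms by (subst volume_B) auto
    then show ?thesis using 2 assms by (intro exI[of _ "r + 1"] exI[of _ "s - 1"]) auto
  next
    case 3
    \<comment> \<open>The volume is \<open>2 + 4 - 3 - 4\<close>. The last 4, at
      \<open>(r + 2, s - 1)\<close>, needs \<open>s \<ge> 5\<close>, which follows from
      \<open>r + s = n + 2 \<ge> 9\<close> and \<open>r \<le> s\<close>.\<close>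
    then have "volume (Q_B n) r (r + 2) (s - 1) s = -1"
      using assms by (subst volume_B) auto
    then show ?thesis using 3 assms by (intro exI[of _ "r + 2"] exI[of _ "s - 1"]) auto
  next
    case 4
    then have "volume (Q_B n) r (r + 1) (s - 1) s = -1"
      using assms by (subst volume_B) auto
    then show ?thesis using 4 assms by (intro exI[of _ "r + 1"] exI[of _ "s - 1"]) auto
  qed
qed

lemma opposite_witness:
  assumes "n \<ge> 7" "r \<le> n" "s \<le> n" "differ n r s"
  shows "(\<exists>r' s'. r \<le> r' \<and> r' \<le> n \<and> s' \<le> s \<and> volume (Q_B n) r r' s' s = -1) \<or>
    (\<exists>r' s'. r' \<le> r \<and> s \<le> s' \<and> s' \<le> n \<and> volume (Q_B n) r' r s s' = -1)"
proof (cases "r \<le> s")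
  case True
  then show ?thesis using SW_witness assms by blast
next
  case False
  then obtain a b where ab: "s \<le> a" "a \<le> n" "b \<le> r" "volume (Q_B n) s a b r = -1"
    using SW_witness[of n s r] assms differ_commute by auto
  \<comment> \<open>Transposition leaves \<open>Q_B\<close> unchanged and turns a south-west
    rectangle into a north-east one.\<close>
  moreover have "volume (Q_B n) b r s a = volume (Q_B n) s a b r"
    using assms ab by (simp add: volume_B truncated_commute[of n _ b] truncated_commute[of n _ r])
  ultimately show ?thesis by auto
qed

section \<open>Defects of both functions and duality\<close>

theorem proposition5p1:
  fixes n :: nat
  assumes "n \<ge> 7"
  shows "proper_discrete_quasi_copula n (Q_A n) \<and>
    proper_discrete_quasi_copula n (Q_B n) \<and>
    dual_pair n (Q_A n) (Q_B n)"
proof -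
  let ?A = "truncated n prof_A" and ?B = "truncated n prof_B"
  note A = Q_A_eq[OF assms] and B = Q_B_eq[OF assms]
  \<comment> \<open>In each inequality a single corner carries the function that the other three do
    not. Replacing it there bounds the defect at that corner by \<open>Q_A - Q_B\<close>, in the
    order SE and NW for \<open>Q_A\<close>, then NE and SW for \<open>Q_B\<close>.\<close>
  have ineqs:
    "0 \<le> Q_B n i k + Q_A n j l - Q_A n i l - Q_A n j k"
    "0 \<le> Q_A n i k + Q_B n j l - Q_A n i l - Q_A n j k"
    "0 \<le> Q_B n i k + Q_B n j l - Q_B n i l - Q_A n j k"
    "0 \<le> Q_B n i k + Q_B n j l - Q_A n i l - Q_B n j k"
    if "i \<le> j" "j \<le> n" "k \<le> l" "l \<le> n" for i j k l
  proof -
    have "?A j k + ?A i l \<le> ?B i k + ?A j l"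
      by (intro truncated_rectangle profile_prof_A line_BA_AA order_refl prof_A_le_prof_B that)
    moreover have "?A j k + ?A i l \<le> ?A i k + ?B j l"
      by (intro truncated_rectangle profile_prof_A line_AB_AA order_refl prof_A_le_prof_B that)
    moreover have "?A j k + ?B i l \<le> ?B i k + ?B j l"
      by (intro truncated_rectangle profile_prof_A profile_prof_B line_BB_AB order_refl
          prof_A_le_prof_B that)
    moreover have "?B j k + ?A i l \<le> ?B i k + ?B j l"
      by (intro truncated_rectangle profile_prof_A profile_prof_B line_BB_BA order_refl
          prof_A_le_prof_B that)
    ultimately show
      "0 \<le> Q_B n i k + Q_A n j l - Q_A n i l - Q_A n j k"
      "0 \<le> Q_A n i k + Q_B n j l - Q_A n i l - Q_A n j k"
      "0 \<le> Q_B n i k + Q_B n j l - Q_B n i l - Q_A n j k"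
      "0 \<le> Q_B n i k + Q_B n j l - Q_A n i l - Q_B n j k"
      using that by (simp_all add: A B)
  qed
  have diff: "Q_A n r s - Q_B n r s = (if differ n r s then -1 else 0)" if "r \<le> n" "s \<le> n" for r s
    using that by (simp add: A B truncated_prof_B)
  have main: "main_defect n (Q_A n) r s = Q_A n r s - Q_B n r s" if "r \<le> n" "s \<le> n" for r s
  proof (rule main_defect_eqI)
    show "Q_A n r s - Q_B n r s \<le> volume (Q_A n) r r' s s'"
      if "r \<le> r'" "r' \<le> n" "s \<le> s'" "s' \<le> n" for r' s'
      using ineqs(1)[OF that] unfolding volume_def by linarith
    show "Q_A n r s - Q_B n r s \<le> volume (Q_A n) r' r s' s" if "r' \<le> r" "s' \<le> s" for r' s'
      using ineqs(2)[OF that(1) \<open>r \<le> n\<close> that(2) \<open>s \<le> n\<close>] unfolding volume_def by linarith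
    show "(\<exists>r' s'. r \<le> r' \<and> r' \<le> n \<and> s \<le> s' \<and> s' \<le> n \<and>
          volume (Q_A n) r r' s s' = Q_A n r s - Q_B n r s) \<or>
        (\<exists>r' s'. r' \<le> r \<and> s' \<le> s \<and> volume (Q_A n) r' r s' s = Q_A n r s - Q_B n r s)"
    proof (cases "differ n r s")
      case True
      then show ?thesis using main_witness[OF assms that] diff[OF that] by simp
    next
      case False
      \<comment> \<open>Where the two functions agree, the bound 0 is attained by the degenerate
        rectangle.\<close>
      have "volume (Q_A n) r r s s = 0" by (simp add: volume_def)
      then show ?thesis using False diff[OF that] that
        by (intro disjI1 exI[of _ r] exI[of _ s]) simp
    qed
  qed fact+
  have opposite: "opposite_defect n (Q_B n) r s = Q_A n r s - Q_B n r s"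
    if "r \<le> n" "s \<le> n" for r s
  proof (rule opposite_defect_eqI)
    show "Q_A n r s - Q_B n r s \<le> volume (Q_B n) r r' s' s"
      if "r \<le> r'" "r' \<le> n" "s' \<le> s" for r' s'
      using ineqs(4)[OF that \<open>s \<le> n\<close>] unfolding volume_def by linarith
    show "Q_A n r s - Q_B n r s \<le> volume (Q_B n) r' r s s'"
      if "r' \<le> r" "s \<le> s'" "s' \<le> n" for r' s'
      using ineqs(3)[OF that(1) \<open>r \<le> n\<close> that(2,3)] unfolding volume_def by linarith
    show "(\<exists>r' s'. r \<le> r' \<and> r' \<le> n \<and> s' \<le> s \<and>
          volume (Q_B n) r r' s' s = Q_A n r s - Q_B n r s) \<or>
        (\<exists>r' s'. r' \<le> r \<and> s \<le> s' \<and> s' \<le> n \<and> volume (Q_B n) r' r s s' = Q_A n r s - Q_B n r s)"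
    proof (cases "differ n r s")
      case True
      then show ?thesis using opposite_witness[OF assms that] diff[OF that] by simp
    next
      case False
      have "volume (Q_B n) r r s s = 0" by (simp add: volume_def)
      then show ?thesis using False diff[OF that] that
        by (intro disjI1 exI[of _ r] exI[of _ s]) simp
    qed
  qed fact+
  have qA: "discrete_quasi_copula n (Q_A n)" and qB: "discrete_quasi_copula n (Q_B n)"
    using discrete_quasi_copula_truncated A B profile_prof_A profile_prof_B by blast+
  have proper: "proper_discrete_quasi_copula n Q"
    if "discrete_quasi_copula n Q" "i \<le> j" "j \<le> n" "k \<le> l" "l \<le> n" "volume Q i j k l = -1"
    for Q i j k l
  proof -
    have "volume Q i j k l < 0" using that(6) by simp
    with that show ?thesis unfolding proper_discrete_quasi_copula_def by blast
  qed
  \<comment> \<open>One point where the functions differ suffices for properness: both witness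
    lemmas supply a negative rectangle there.\<close>
  have differ: "differ n 2 (n - 2)" and le: "2 \<le> n" "n - 2 \<le> n"
    using assms unfolding differ_def by auto
  have pA: "proper_discrete_quasi_copula n (Q_A n)"
    using main_witness[OF assms le differ] proper[OF qA] le by blast
  have pB: "proper_discrete_quasi_copula n (Q_B n)"
    using opposite_witness[OF assms le differ] proper[OF qB] le by blast
  have "discrete_imprecise_copula n (Q_A n) (Q_B n)"
    unfolding discrete_imprecise_copula_def
    using qA qB unfolding discrete_quasi_copula_def
    by (intro conjI allI impI ineqs pA pB) simp_all
  moreover have "Q_M n (Q_A n) r s = Q_B n r s" "Q_O n (Q_B n) r s = Q_A n r s"
    if "r \<le> n" "s \<le> n" for r s
    using that by (simp_all add: Q_M_def Q_O_def main opposite)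
  ultimately show ?thesis
    using pA pB unfolding dual_pair_def by simp
qed

end
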